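(* Let $Y$ be a closed sublattice of $\ell_\infty$. Then: (i) $Y$ is an ideal of $\ell_\infty$ if and only if there is an ideal $\mathcal I$ on $\mathbb N$ (not necessarily containing $\mathsf{Fin}$) such that $Y=c_{0,\mathcal I}$. (ii) For an ideal $\mathcal I$ on $\mathbb N$ (not necessarily containing $\mathsf{Fin}$), $c_0\subseteq c_{0,\mathcal I}$ if and only if $\mathsf{Fin}\subseteq\mathcal I$. (iii) For each $A\subseteq\mathbb N$, let $Z_A=\{\mathbf x=(x_n)\in\ell_\infty: x_n=0\text{ for all }n\in A\}$. For each closed ideal $Y$ of $\ell_\infty$, if $A=\{n\in\mathbb N:\chi_{\{n\}}\notin Y\}$, then $Y=\langle Y\cup c_0\rangle\cap Z_A$.
   Context: In this statement an ideal on $\mathbb N$ is a collection of subsets of $\mathbb N$ containing $\emptyset$, closed under taking subsets and under finite unions (it is not required to contain the finite sets, nor to be proper). $\mathsf{Fin}$ is the collection of finite subsets of $\mathbb N$. $\ell_\infty$ is the real Banach lattice of bounded real sequences with sup norm and pointwise order. $c_{0,\mathcal I}$ is the set of $(x_n)\in\ell_\infty$ such that $\{n\in\mathbb N:|x_n|\ge\varepsilon\}\in\mathcal I$ for every $\varepsilon>0$. A sublattice $Y$ (linear subspace closed under lattice operations) of a Banach lattice $X$ is an ideal of $X$ if $x\in Y$ whenever $x\in X$ and $|x|\le|y|$ for some $y\in Y$. $\langle B\rangle$ denotes the closed ideal of $\ell_\infty$ generated by $B\subseteq\ell_\infty$. $\chi_{\{n\}}$ is the characteristic function of $\{n\}$.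 *)

theory Defs
  imports "HOL-Analysis.Analysis" "HOL-Library.Lattice_Algebras"
begin

unbundle bcontfun.lifting

subsection \<open>The pointwise order on bounded continuous functions\<close>

instantiation bcontfun :: (topological_space, "{metric_space, linorder_topology}") lattice
begin

lift_definition less_eq_bcontfun :: "('a \<Rightarrow>\<^sub>C 'b) \<Rightarrow> ('a \<Rightarrow>\<^sub>C 'b) \<Rightarrow> bool"
  is "\<lambda>f g. \<forall>x. f x \<le> g x" .

definition less_bcontfun :: "('a \<Rightarrow>\<^sub>C 'b) \<Rightarrow> ('a \<Rightarrow>\<^sub>C 'b) \<Rightarrow> bool"
  where "less_bcontfun f g \<longleftrightarrow> f \<le> g \<and> \<not> g \<le> f"

lift_definition sup_bcontfun :: "('a \<Rightarrow>\<^sub>C 'b) \<Rightarrow> ('a \<Rightarrow>\<^sub>C 'b) \<Rightarrow> 'a \<Rightarrow>\<^sub>C 'b"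
  is "\<lambda>f g x. max (f x) (g x)"
proof -
  fix f g :: "'a \<Rightarrow> 'b"
  assume "f \<in> bcontfun" "g \<in> bcontfun"
  moreover have "range (\<lambda>x. max (f x) (g x)) \<subseteq> range f \<union> range g"
    by (auto simp: max_def)
  ultimately show "(\<lambda>x. max (f x) (g x)) \<in> bcontfun"
    by (auto simp: bcontfun_def intro!: continuous_on_max intro: bounded_subset[of "range f \<union> range g"])
qed

lift_definition inf_bcontfun :: "('a \<Rightarrow>\<^sub>C 'b) \<Rightarrow> ('a \<Rightarrow>\<^sub>C 'b) \<Rightarrow> 'a \<Rightarrow>\<^sub>C 'b"
  is "\<lambda>f g x. min (f x) (g x)"
proof -
  fix f g :: "'a \<Rightarrow> 'b"
  assume "f \<in> bcontfun" "g \<in> bcontfun"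
  moreover have "range (\<lambda>x. min (f x) (g x)) \<subseteq> range f \<union> range g"
    by (auto simp: min_def)
  ultimately show "(\<lambda>x. min (f x) (g x)) \<in> bcontfun"
    by (auto simp: bcontfun_def intro!: continuous_on_min intro: bounded_subset[of "range f \<union> range g"])
qed

instance
proof
  fix f g h :: "'a \<Rightarrow>\<^sub>C 'b"
  show "f < g \<longleftrightarrow> f \<le> g \<and> \<not> g \<le> f" by (rule less_bcontfun_def)
  show "f \<le> f" by transfer simp
  show "f \<le> g \<Longrightarrow> g \<le> h \<Longrightarrow> f \<le> h" by transfer (blast intro: order_trans)
  show "f \<le> g \<Longrightarrow> g \<le> f \<Longrightarrow> f = g" by transfer (auto intro!: ext order_antisym)
  show "inf f g \<le> f" "inf f g \<le> g" "f \<le> sup f g" "g \<le> sup f g" by (transfer, simp)+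
  show "f \<le> g \<Longrightarrow> f \<le> h \<Longrightarrow> f \<le> inf g h" by transfer simp
  show "g \<le> f \<Longrightarrow> h \<le> f \<Longrightarrow> sup g h \<le> f" by transfer simp
qed

end

instantiation bcontfun ::
  (topological_space, "{real_normed_vector, linorder_topology, ordered_real_vector}")
  lattice_ab_group_add_abs
begin

definition abs_bcontfun :: "('a \<Rightarrow>\<^sub>C 'b) \<Rightarrow> 'a \<Rightarrow>\<^sub>C 'b"
  where "abs_bcontfun f = sup f (- f)"

instance
proof
  fix f g h :: "'a \<Rightarrow>\<^sub>C 'b"
  show "f \<le> g \<Longrightarrow> h + f \<le> h + g" by transfer simp
  show "\<bar>f\<bar> = sup f (- f)" by (rule abs_bcontfun_def)
qed

end

instance bcontfun ::
  (topological_space, "{real_normed_vector, linorder_topology, ordered_real_vector}")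
  ordered_real_vector
proof
  fix f g :: "'a \<Rightarrow>\<^sub>C 'b" and a b :: real
  show "f \<le> g \<Longrightarrow> 0 \<le> a \<Longrightarrow> a *\<^sub>R f \<le> a *\<^sub>R g"
    by transfer (auto intro: scaleR_left_mono)
  show "a \<le> b \<Longrightarrow> 0 \<le> f \<Longrightarrow> a *\<^sub>R f \<le> b *\<^sub>R f"
    by transfer (auto intro: scaleR_right_mono)
qed

lemma apply_abs_bcontfun: "apply_bcontfun \<bar>f\<bar> x = \<bar>apply_bcontfun f x\<bar>"
  for f :: "'a::topological_space \<Rightarrow>\<^sub>C real"
  by (simp add: abs_bcontfun_def sup_bcontfun.rep_eq uminus_bcontfun.rep_eq abs_real_def max_def)

lemma bcontfun_abs_le_imp_norm_le: "\<bar>f\<bar> \<le> \<bar>g\<bar> \<Longrightarrow> norm f \<le> norm g"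
  for f g :: "'a::topological_space \<Rightarrow>\<^sub>C real"
  by (rule norm_bound)
    (metis apply_abs_bcontfun less_eq_bcontfun.rep_eq norm_bounded order_trans real_norm_def)


subsection \<open>Sublattices and ideals of a vector lattice\<close>

definition vector_sublattice :: "'a::{real_vector, lattice} set \<Rightarrow> bool"
  where "vector_sublattice Y \<longleftrightarrow>
    subspace Y \<and> (\<forall>x\<in>Y. \<forall>y\<in>Y. sup x y \<in> Y \<and> inf x y \<in> Y)"

definition vector_lattice_ideal :: "'a::{real_vector, lattice, abs} set \<Rightarrow> bool"
  where "vector_lattice_ideal Y \<longleftrightarrow>
    vector_sublattice Y \<and> (\<forall>x. \<forall>y\<in>Y. \<bar>x\<bar> \<le> \<bar>y\<bar> \<longrightarrow> x \<in> Y)"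

definition closed_ideal :: "'a::{real_normed_vector, lattice, abs} set \<Rightarrow> bool"
  where "closed_ideal Y \<longleftrightarrow> vector_lattice_ideal Y \<and> closed Y"

definition closed_ideal_generated :: "'a::{real_normed_vector, lattice, abs} set \<Rightarrow> 'a set"
  where "closed_ideal_generated B = closed_ideal hull B"


subsection \<open>Bounded sequences and ideals of sets\<close>

text \<open>
  The topology on \<^typ>\<open>nat\<close> is discrete, so the bounded continuous functions on it
  are exactly the bounded sequences.
\<close>
type_synonym linfty = "nat \<Rightarrow>\<^sub>C real"

lift_definition char_seq :: "nat set \<Rightarrow> linfty" is "\<lambda>A. indicator A"
  by (rule bcontfun_normI[where b = 1]) (auto simp: indicator_def)

definition c0 :: "linfty set"
  where "c0 = {x. (\<lambda>n. apply_bcontfun x n) \<longlonglongrightarrow> 0}"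

text \<open>Neither properness nor membership of the finite sets is required.\<close>
definition set_ideal :: "'a set set \<Rightarrow> bool"
  where "set_ideal \<I> \<longleftrightarrow> {} \<in> \<I> \<and> (\<forall>A\<in>\<I>. \<forall>B. B \<subseteq> A \<longrightarrow> B \<in> \<I>)
    \<and> (\<forall>A\<in>\<I>. \<forall>B\<in>\<I>. A \<union> B \<in> \<I>)"

definition Fin :: "nat set set"
  where "Fin = {A. finite A}"

definition c0_ideal :: "nat set set \<Rightarrow> linfty set"
  where "c0_ideal \<I> = {x. \<forall>\<epsilon>>0. {n. \<bar>apply_bcontfun x n\<bar> \<ge> \<epsilon>} \<in> \<I>}"

definition vanishing_on :: "nat set \<Rightarrow> linfty set"
  where "vanishing_on A = {x. \<forall>n\<in>A. apply_bcontfun x n = 0}"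

end

(*
  A closed ideal Y of l_infinity is determined by the sets whose characteristic functions lie
  in Y: if x is in Y, then the characteristic function of {n. |x n| >= e} is at most |x| / e;
  conversely, x is a uniform limit of its truncations to the sets {n. |x n| >= e}, each
  dominated by a multiple of a characteristic function. For (iii), write Y = c_{0,I}. The sets S
  with S - A in I form an ideal J containing I and every finite set, so c_{0,J} contains the
  closed ideal generated by Y and c_0; and a sequence in c_{0,J} that vanishes on A lies in
  c_{0,I}.
*)
theory Submission
  imports Defs
begin

lemma apply_char_seq [simp]: "apply_bcontfun (char_seq A) n = indicator A n"
  by (simp add: char_seq.rep_eq)

lemma abs_le_abs_bcontfun_iff:
  fixes f g :: "'a::topological_space \<Rightarrow>\<^sub>C real"
  shows "\<bar>f\<bar> \<le> \<bar>g\<bar> \<longleftrightarrow> (\<forall>x. \<bar>apply_bcontfun f x\<bar> \<le> \<bar>apply_bcontfun g x\<bar>)"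
  by (simp add: less_eq_bcontfun.rep_eq apply_abs_bcontfun)

lemma set_ideal_subset: "set_ideal \<I> \<Longrightarrow> A \<in> \<I> \<Longrightarrow> B \<subseteq> A \<Longrightarrow> B \<in> \<I>"
  unfolding set_ideal_def by blast

lemma set_ideal_Un: "set_ideal \<I> \<Longrightarrow> A \<in> \<I> \<Longrightarrow> B \<in> \<I> \<Longrightarrow> A \<union> B \<in> \<I>"
  unfolding set_ideal_def by blast

text \<open>Singletons are required only for the points of \<open>A\<close>, since an ideal here may
  miss some of them.\<close>

lemma set_ideal_finite:
  assumes "set_ideal \<I>" "finite A" "\<And>a. a \<in> A \<Longrightarrow> {a} \<in> \<I>"
  shows "A \<in> \<I>"
  using assms(2,3)
proof (induction A rule: finite_induct)
  case empty
  then show ?case using assms(1) by (simp add: set_ideal_def)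
next
  case (insert a A)
  then have "{a} \<union> A \<in> \<I>" by (intro set_ideal_Un[OF assms(1)]) auto
  then show ?case by simp
qed

lemma c0_idealD: "x \<in> c0_ideal \<I> \<Longrightarrow> \<epsilon> > 0 \<Longrightarrow> {n. \<bar>apply_bcontfun x n\<bar> \<ge> \<epsilon>} \<in> \<I>"
  unfolding c0_ideal_def by blast

text \<open>If both summands on the right are below \<open>\<epsilon> / 2\<close> at
  \<open>n\<close>, then \<open>z\<close> is below \<open>\<epsilon>\<close> there. This single
  criterion gives closure under sums, under \<open>sup\<close> and \<open>inf\<close>, and under
  domination.\<close>

lemma c0_idealI_Un:
  assumes "set_ideal \<I>" "x \<in> c0_ideal \<I>" "y \<in> c0_ideal \<I>"
    and le: "\<And>n. \<bar>apply_bcontfun z n\<bar> \<le> \<bar>apply_bcontfun x n\<bar> + \<bar>apply_bcontfun y n\<bar>"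
  shows "z \<in> c0_ideal \<I>"
  unfolding c0_ideal_def
proof (intro CollectI allI impI)
  fix \<epsilon> :: real assume "\<epsilon> > 0"
  then have "\<epsilon> / 2 > 0" by simp
  note in_\<I> = c0_idealD[OF assms(2) this] c0_idealD[OF assms(3) this]
  have "\<epsilon> / 2 \<le> \<bar>apply_bcontfun x n\<bar> \<or> \<epsilon> / 2 \<le> \<bar>apply_bcontfun y n\<bar>"
    if "\<epsilon> \<le> \<bar>apply_bcontfun z n\<bar>" for n
    using that le[of n] by linarith
  then have "{n. \<epsilon> \<le> \<bar>apply_bcontfun z n\<bar>}
      \<subseteq> {n. \<epsilon> / 2 \<le> \<bar>apply_bcontfun x n\<bar>} \<union> {n. \<epsilon> / 2 \<le> \<bar>apply_bcontfun y n\<bar>}"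
    by blast
  then show "{n. \<epsilon> \<le> \<bar>apply_bcontfun z n\<bar>} \<in> \<I>"
    by (rule set_ideal_subset[OF assms(1) set_ideal_Un[OF assms(1) in_\<I>]])
qed

text \<open>An element within \<open>\<epsilon> / 2\<close> of \<open>x\<close> still has size at
  least \<open>\<epsilon> / 2\<close> wherever \<open>x\<close> has size at least
  \<open>\<epsilon>\<close>.\<close>

lemma closed_c0_ideal:
  assumes "set_ideal \<I>"
  shows "closed (c0_ideal \<I>)"
proof -
  have "x \<in> c0_ideal \<I>" if x: "x \<in> closure (c0_ideal \<I>)" for x
    unfolding c0_ideal_def
  proof (intro CollectI allI impI)
    fix \<epsilon> :: real assume "\<epsilon> > 0"
    then obtain y where y: "y \<in> c0_ideal \<I>" "dist y x < \<epsilon> / 2"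
      using x unfolding closure_approachable by (meson half_gt_zero)
    have close: "\<bar>apply_bcontfun y n - apply_bcontfun x n\<bar> < \<epsilon> / 2" for n
      using dist_bounded[of y n x] y(2) by (simp add: dist_real_def)
    have "\<epsilon> / 2 \<le> \<bar>apply_bcontfun y n\<bar>" if "\<epsilon> \<le> \<bar>apply_bcontfun x n\<bar>" for n
      using that close[of n] by linarith
    then have "{n. \<epsilon> \<le> \<bar>apply_bcontfun x n\<bar>} \<subseteq> {n. \<epsilon> / 2 \<le> \<bar>apply_bcontfun y n\<bar>}"
      by blast
    then show "{n. \<epsilon> \<le> \<bar>apply_bcontfun x n\<bar>} \<in> \<I>"
      by (rule set_ideal_subset[OF assms c0_idealD[OF y(1) half_gt_zero[OF \<open>\<epsilon> > 0\<close>]]])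
  qed
  then show ?thesis by (metis closure_subset closure_eq subsetI subset_antisym)
qed

lemma closed_ideal_c0_ideal:
  assumes \<I>: "set_ideal \<I>"
  shows "closed_ideal (c0_ideal \<I>)"
proof -
  have zero: "0 \<in> c0_ideal \<I>"
    using \<I> by (auto simp: c0_ideal_def set_ideal_def not_le)
  note Un = c0_idealI_Un[OF \<I>]
  have scale: "c *\<^sub>R x \<in> c0_ideal \<I>" if "x \<in> c0_ideal \<I>" for c x
    unfolding c0_ideal_def
  proof (intro CollectI allI impI)
    fix \<epsilon> :: real assume \<epsilon>: "\<epsilon> > 0"
    show "{n. \<epsilon> \<le> \<bar>apply_bcontfun (c *\<^sub>R x) n\<bar>} \<in> \<I>"
    proof (cases "c = 0")
      case True
      then show ?thesis using c0_idealD[OF zero \<epsilon>] by simp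
    next
      case False
      then have "{n. \<epsilon> \<le> \<bar>apply_bcontfun (c *\<^sub>R x) n\<bar>} = {n. \<epsilon> / \<bar>c\<bar> \<le> \<bar>apply_bcontfun x n\<bar>}"
        by (auto simp: abs_mult field_simps)
      then show ?thesis using c0_idealD[OF that, of "\<epsilon> / \<bar>c\<bar>"] \<epsilon> False by simp
    qed
  qed
  have "x + y \<in> c0_ideal \<I>" if "x \<in> c0_ideal \<I>" "y \<in> c0_ideal \<I>" for x y
    using that by (rule Un) (simp add: abs_triangle_ineq)
  then have "subspace (c0_ideal \<I>)"
    using zero scale by (simp add: subspace_def)
  \<comment> \<open>At each point the maximum and the minimum are one of the two values, so both are
    bounded by the sum of the absolute values.\<close>
  moreover have "sup x y \<in> c0_ideal \<I> \<and> inf x y \<in> c0_ideal \<I>"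
    if "x \<in> c0_ideal \<I>" "y \<in> c0_ideal \<I>" for x y
    using Un[OF that, of "sup x y"] Un[OF that, of "inf x y"]
    by (simp add: sup_bcontfun.rep_eq inf_bcontfun.rep_eq max_def min_def)
  \<comment> \<open>Domination by one element is the case where the second summand is 0.\<close>
  moreover have "x \<in> c0_ideal \<I>" if "y \<in> c0_ideal \<I>" "\<bar>x\<bar> \<le> \<bar>y\<bar>" for x y
    using that(2) by (intro Un[OF that(1) zero]) (simp add: abs_le_abs_bcontfun_iff)
  ultimately show ?thesis
    using closed_c0_ideal[OF \<I>]
    unfolding closed_ideal_def vector_lattice_ideal_def vector_sublattice_def by blast
qed

lemma vector_lattice_ideal_dominated:
  fixes Y :: "linfty set"
  assumes "vector_lattice_ideal Y" "y \<in> Y"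
    and "\<And>n. \<bar>apply_bcontfun x n\<bar> \<le> c * \<bar>apply_bcontfun y n\<bar>"
  shows "x \<in> Y"
proof -
  have "c *\<^sub>R y \<in> Y"
    using assms(1,2)
    by (simp add: vector_lattice_ideal_def vector_sublattice_def subspace_def)
  moreover have "\<bar>x\<bar> \<le> \<bar>c *\<^sub>R y\<bar>"
    unfolding abs_le_abs_bcontfun_iff
  proof
    fix n
    \<comment> \<open>No sign is assumed for \<open>c\<close>, while the modulus of
      \<open>c *\<^sub>R y\<close> carries the factor \<open>\<bar>c\<bar>\<close>.\<close>
    have "c * \<bar>apply_bcontfun y n\<bar> \<le> \<bar>c\<bar> * \<bar>apply_bcontfun y n\<bar>"
      by (intro mult_right_mono) auto
    then show "\<bar>apply_bcontfun x n\<bar> \<le> \<bar>apply_bcontfun (c *\<^sub>R y) n\<bar>"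
      using assms(3)[of n] by (simp add: abs_mult)
  qed
  ultimately show ?thesis using assms(1) unfolding vector_lattice_ideal_def by blast
qed

text \<open>Subsets are handled by domination; for unions, the characteristic sequence of
  \<open>A \<union> B\<close> is at most the sum of the two given ones.\<close>

lemma set_ideal_char_seq:
  assumes Y: "vector_lattice_ideal Y"
  shows "set_ideal {S. char_seq S \<in> Y}"
proof -
  have zero: "0 \<in> Y" and add: "\<And>x y. x \<in> Y \<Longrightarrow> y \<in> Y \<Longrightarrow> x + y \<in> Y"
    using Y by (auto simp: vector_lattice_ideal_def vector_sublattice_def subspace_def)
  have "char_seq {} \<in> Y"
    by (rule vector_lattice_ideal_dominated[OF Y zero, of _ 1]) simp
  moreover have "char_seq B \<in> Y" if "char_seq A \<in> Y" "B \<subseteq> A" for A B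
    by (rule vector_lattice_ideal_dominated[OF Y that(1), of _ 1])
      (use that(2) in \<open>auto simp: indicator_def\<close>)
  moreover have "char_seq (A \<union> B) \<in> Y" if "char_seq A \<in> Y" "char_seq B \<in> Y" for A B
    by (rule vector_lattice_ideal_dominated[OF Y add[OF that], of _ 1]) (simp add: indicator_def)
  ultimately show ?thesis unfolding set_ideal_def by blast
qed

text \<open>The first inclusion rests on domination alone; closedness of \<open>Y\<close> enters in
  the second, where \<open>x\<close> is recovered as a limit.\<close>

lemma closed_ideal_eq_c0_ideal:
  assumes "closed_ideal Y"
  shows "Y = c0_ideal {S. char_seq S \<in> Y}"
proof
  have Y: "vector_lattice_ideal Y" and "closed Y"
    using assms by (auto simp: closed_ideal_def)
  show "Y \<subseteq> c0_ideal {S. char_seq S \<in> Y}"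
  proof
    fix x assume x: "x \<in> Y"
    have "char_seq {n. \<epsilon> \<le> \<bar>apply_bcontfun x n\<bar>} \<in> Y" if "\<epsilon> > 0" for \<epsilon>
      using that by (intro vector_lattice_ideal_dominated[OF Y x, of _ "1 / \<epsilon>"])
        (auto simp: indicator_def field_simps)
    then show "x \<in> c0_ideal {S. char_seq S \<in> Y}"
      by (simp add: c0_ideal_def)
  qed
  show "c0_ideal {S. char_seq S \<in> Y} \<subseteq> Y"
  proof
    fix x assume x: "x \<in> c0_ideal {S. char_seq S \<in> Y}"
    have "\<exists>y\<in>Y. dist y x < e" if "e > 0" for e
    proof -
      \<comment> \<open>Truncation at level \<open>\<epsilon>\<close> yields only the weak bound
        \<open>dist y x \<le> \<epsilon>\<close>, so a level strictly below \<open>e\<close> is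
        taken.\<close>
      define \<epsilon> where "\<epsilon> = e / 2"
      have \<epsilon>: "0 < \<epsilon>" "\<epsilon> < e" using that by (auto simp: \<epsilon>_def)
      define S where "S = {n. \<epsilon> \<le> \<bar>apply_bcontfun x n\<bar>}"
      have S: "char_seq S \<in> Y"
        using c0_idealD[OF x \<epsilon>(1)] by (simp add: S_def)
      have x_le: "\<bar>apply_bcontfun x n\<bar> \<le> norm x" for n
        using norm_bounded[of x n] by simp
      have "(\<lambda>n. indicator S n * apply_bcontfun x n) \<in> bcontfun"
        using x_le by (intro bcontfun_normI[where b = "norm x"]) (auto simp: indicator_def)
      then obtain y where y: "\<And>n. apply_bcontfun y n = indicator S n * apply_bcontfun x n"
        by (metis bcontfun.Bcontfun_inverse)
      have "y \<in> Y"
        using x_le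
        by (intro vector_lattice_ideal_dominated[OF Y S, of _ "norm x"])
          (auto simp: y indicator_def)
      \<comment> \<open>The truncation \<open>y\<close> differs from \<open>x\<close> only off
        \<open>S\<close>, where \<open>x\<close> is smaller than \<open>\<epsilon>\<close>.\<close>
      moreover have "dist y x \<le> \<epsilon>"
        using \<epsilon> by (intro dist_bound) (auto simp: y dist_real_def S_def indicator_def)
      ultimately show ?thesis using \<epsilon>(2) by force
    qed
    then show "x \<in> Y" using closed_approachable[OF \<open>closed Y\<close>] by blast
  qed
qed

text \<open>A finite set is the level set at height 1 of its characteristic sequence, which is
  eventually zero; conversely, the level sets of a null sequence at positive heights are
  finite.\<close>

lemma c0_subset_c0_ideal_iff:
  assumes "set_ideal \<I>"
  shows "c0 \<subseteq> c0_ideal \<I> \<longleftrightarrow> Fin \<subseteq> \<I>"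
proof
  assume le: "c0 \<subseteq> c0_ideal \<I>"
  show "Fin \<subseteq> \<I>"
  proof
    fix F assume "F \<in> Fin"
    then have fin: "finite F" by (simp add: Fin_def)
    then have "\<forall>\<^sub>F n in sequentially. indicator F n = (0 :: real)"
      by (auto simp: cofinite_eq_sequentially[symmetric] eventually_cofinite indicator_def)
    then have "char_seq F \<in> c0"
      by (simp add: c0_def tendsto_eventually)
    then have "{n. 1 \<le> \<bar>apply_bcontfun (char_seq F) n\<bar>} \<in> \<I>"
      using le by (intro c0_idealD) auto
    also have "{n. 1 \<le> \<bar>apply_bcontfun (char_seq F) n\<bar>} = F"
      by (auto simp: indicator_def split: if_splits)
    finally show "F \<in> \<I>" .
  qed
next
  assume le: "Fin \<subseteq> \<I>"
  have "finite {n. \<epsilon> \<le> \<bar>apply_bcontfun x n\<bar>}" if "x \<in> c0" "\<epsilon> > 0" for x \<epsilon>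
  proof -
    have "\<forall>\<^sub>F n in sequentially. \<bar>apply_bcontfun x n\<bar> < \<epsilon>"
      using that by (auto simp: c0_def tendsto_iff dist_real_def)
    then show ?thesis
      by (simp add: cofinite_eq_sequentially[symmetric] eventually_cofinite not_less)
  qed
  then show "c0 \<subseteq> c0_ideal \<I>"
    using le by (auto simp: c0_ideal_def Fin_def)
qed

lemma closed_ideal_eq_generated_Int_vanishing_on:
  fixes Z :: "linfty set"
  assumes Z: "closed_ideal Z" and A: "A = {n. char_seq {n} \<notin> Z}"
  shows "Z = closed_ideal_generated (Z \<union> c0) \<inter> vanishing_on A"
proof
  define \<I> where "\<I> = {S. char_seq S \<in> Z}"
  have \<I>: "set_ideal \<I>" and Z_eq: "Z = c0_ideal \<I>"
    using Z set_ideal_char_seq closed_ideal_eq_c0_ideal[OF Z]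
    by (auto simp: \<I>_def closed_ideal_def)
  \<comment> \<open>A member of \<open>\<I>\<close> containing \<open>n\<close> would force
    \<open>{n}\<close> into \<open>\<I>\<close>, contrary to the choice of \<open>A\<close>.\<close>
  have disjoint: "n \<notin> S" if "S \<in> \<I>" "n \<in> A" for n S
    using that set_ideal_subset[OF \<I> that(1), of "{n}"] by (auto simp: A \<I>_def)
  show "Z \<subseteq> closed_ideal_generated (Z \<union> c0) \<inter> vanishing_on A"
  proof
    fix x assume x: "x \<in> Z"
    have "apply_bcontfun x n = 0" if "n \<in> A" for n
      \<comment> \<open>If \<open>x\<close> were nonzero at \<open>n\<close>, its level set at
        height \<open>\<bar>apply_bcontfun x n\<bar>\<close> would be a member of
        \<open>\<I>\<close> containing \<open>n\<close>.\<close>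
      using c0_idealD[OF x[unfolded Z_eq], of "\<bar>apply_bcontfun x n\<bar>"] disjoint[OF _ that]
      by force
    moreover have "x \<in> closed_ideal_generated (Z \<union> c0)"
      using x hull_subset[of "Z \<union> c0" closed_ideal] by (auto simp: closed_ideal_generated_def)
    ultimately show "x \<in> closed_ideal_generated (Z \<union> c0) \<inter> vanishing_on A"
      by (simp add: vanishing_on_def)
  qed
  \<comment> \<open>This is the ideal of sets generated by \<open>\<I>\<close> and
    \<open>A\<close>.\<close>
  define \<J> where "\<J> = {S. S - A \<in> \<I>}"
  have \<J>: "set_ideal \<J>"
    using \<I> unfolding set_ideal_def \<J>_def
    by (auto simp: Un_Diff) (meson Diff_mono order_refl)
  have "\<I> \<subseteq> \<J>"
    using set_ideal_subset[OF \<I>] by (auto simp: \<J>_def)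
  then have "Z \<subseteq> c0_ideal \<J>"
    by (auto simp: Z_eq c0_ideal_def)
  \<comment> \<open>By the choice of \<open>A\<close>, every singleton outside \<open>A\<close> lies
    in \<open>\<I>\<close>, hence so does \<open>S - A\<close> for finite \<open>S\<close>.\<close>
  moreover have "Fin \<subseteq> \<J>"
    by (auto simp: Fin_def \<J>_def A \<I>_def intro!: set_ideal_finite[OF \<I>[unfolded \<I>_def], simplified])
  ultimately have gen: "closed_ideal_generated (Z \<union> c0) \<subseteq> c0_ideal \<J>"
    unfolding closed_ideal_generated_def
    using \<J> by (intro hull_minimal) (auto simp: c0_subset_c0_ideal_iff closed_ideal_c0_ideal)
  show "closed_ideal_generated (Z \<union> c0) \<inter> vanishing_on A \<subseteq> Z"
  proof
    fix x assume x: "x \<in> closed_ideal_generated (Z \<union> c0) \<inter> vanishing_on A"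
    have "{n. \<epsilon> \<le> \<bar>apply_bcontfun x n\<bar>} \<in> \<I>" if "\<epsilon> > 0" for \<epsilon>
    proof -
      have "{n. \<epsilon> \<le> \<bar>apply_bcontfun x n\<bar>} - A \<in> \<I>"
        using c0_idealD[of x \<J> \<epsilon>] x gen that by (auto simp: \<J>_def)
      \<comment> \<open>As \<open>x\<close> is zero on \<open>A\<close>, its level sets at positive
        heights do not meet \<open>A\<close>.\<close>
      also have "{n. \<epsilon> \<le> \<bar>apply_bcontfun x n\<bar>} - A = {n. \<epsilon> \<le> \<bar>apply_bcontfun x n\<bar>}"
        using x that by (auto simp: vanishing_on_def)
      finally show ?thesis .
    qed
    then show "x \<in> Z" by (simp add: Z_eq c0_ideal_def)
  qed
qed

theorem proposition4p1:
  fixes Y :: "linfty set"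
  assumes "vector_sublattice Y" and "closed Y"
  shows "(vector_lattice_ideal Y \<longleftrightarrow> (\<exists>\<I>. set_ideal \<I> \<and> Y = c0_ideal \<I>))
    \<and> (\<forall>\<I>. set_ideal \<I> \<longrightarrow> (c0 \<subseteq> c0_ideal \<I> \<longleftrightarrow> Fin \<subseteq> \<I>))
    \<and> (\<forall>(Z :: linfty set) A. closed_ideal Z \<longrightarrow> A = {n. char_seq {n} \<notin> Z} \<longrightarrow>
          Z = closed_ideal_generated (Z \<union> c0) \<inter> vanishing_on A)"
proof -
  have "vector_lattice_ideal Y \<longleftrightarrow> (\<exists>\<I>. set_ideal \<I> \<and> Y = c0_ideal \<I>)"
  proof
    assume "vector_lattice_ideal Y"
    \<comment> \<open>The witness is the family of sets whose characteristic sequence lies in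
      \<open>Y\<close>.\<close>
    then show "\<exists>\<I>. set_ideal \<I> \<and> Y = c0_ideal \<I>"
      using set_ideal_char_seq closed_ideal_eq_c0_ideal \<open>closed Y\<close> closed_ideal_def by blast
  next
    assume "\<exists>\<I>. set_ideal \<I> \<and> Y = c0_ideal \<I>"
    then show "vector_lattice_ideal Y"
      using closed_ideal_c0_ideal by (auto simp: closed_ideal_def)
  qed
  then show ?thesis
    using c0_subset_c0_ideal_iff closed_ideal_eq_generated_Int_vanishing_on by blast
qed

end
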